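(* Every non-decreasing pure $O$-sequence $\underline{h}=(h_0,\dots,h_e)$ of socle degree $e\le 3$ is differentiable.
   Context: For positive integers $n,d$, write $n=\binom{k_d}{d}+\cdots+\binom{k_\delta}{\delta}$ with $k_d>\dots>k_\delta\ge\delta\ge1$ (unique $d$-binomial expansion) and set $(n_{(d)})^1_1=\binom{k_d+1}{d+1}+\cdots+\binom{k_\delta+1}{\delta+1}$; set $(0_{(d)})^1_1=0$. A sequence $(h_0,\dots,h_e)$ of non-negative integers with $h_0=1$ is an $O$-sequence if $h_{d+1}\le((h_d)_{(d)})^1_1$ for all $1\le d<e$. A monomial order ideal is a finite nonempty set of monomials closed under taking divisors; it is pure if all its maximal monomials under divisibility have the same degree $e$, called the socle degree. A pure $O$-sequence is the vector $(h_0,\dots,h_e)$ counting the monomials of each degree in a pure monomial order ideal of socle degree $e$. A sequence is non-decreasing if $h_{i+1}\ge h_i$ for all $i$, and differentiable if $(h_0,h_1-h_0,\dots,h_e-h_{e-1})$ is an $O$-sequence. *)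

theory Defs
  imports Complex_Main "HOL-Library.Multiset"
begin

text \<open>
  The coefficients of an expansion are indexed by the lower entries of the binomials, so only the
  values \<open>k \<delta>, \<dots>, k d\<close> matter.
\<close>

definition binomial_expansion :: "nat \<Rightarrow> nat \<Rightarrow> nat \<Rightarrow> (nat \<Rightarrow> nat) \<Rightarrow> bool" where
  "binomial_expansion d n \<delta> k \<longleftrightarrow>
     1 \<le> \<delta> \<and> \<delta> \<le> d \<and> (\<forall>i. \<delta> \<le> i \<and> i < d \<longrightarrow> k i < k (Suc i)) \<and> \<delta> \<le> k \<delta> \<and>
     n = (\<Sum>i=\<delta>..d. k i choose i)"

text \<open>\<open>macaulay_growth d n\<close> is \<open>(n\<^sub>(\<^sub>d\<^sub>))\<^sup>1\<^sub>1\<close>; the description is well defined for \<open>d, n \<ge> 1\<close> by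
  \<open>binomial_expansion_exists\<close> and \<open>macaulay_growth_eq\<close> below.\<close>

definition macaulay_growth :: "nat \<Rightarrow> nat \<Rightarrow> nat" where
  "macaulay_growth d n =
     (if n = 0 then 0
      else THE m. \<exists>\<delta> k. binomial_expansion d n \<delta> k \<and>
                        m = (\<Sum>i=\<delta>..d. (k i + 1) choose (i + 1)))"

lemma binomial_expansion_less:
  assumes "binomial_expansion d n \<delta> k"
  shows "n < (k d + 1) choose d"
proof -
  have \<delta>: "1 \<le> \<delta>" "\<delta> \<le> d" "\<delta> \<le> k \<delta>" and n: "n = (\<Sum>i=\<delta>..d. k i choose i)"
    and mono: "\<And>i. \<delta> \<le> i \<Longrightarrow> i < d \<Longrightarrow> k i < k (Suc i)"
    using assms by (auto simp: binomial_expansion_def)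
  have "e \<le> d \<Longrightarrow> (\<Sum>i=\<delta>..e. k i choose i) < (k e + 1) choose e" if "\<delta> \<le> e" for e
    using that
  proof (induction e rule: dec_induct)
    case base
    obtain c where c: "\<delta> = Suc c" using \<delta>(1) by (cases \<delta>) auto
    then have "0 < k \<delta> choose c" using \<delta>(3) by (intro zero_less_binomial) simp
    then show ?case using c by simp
  next
    case (step e)
    have "(\<Sum>i=\<delta>..Suc e. k i choose i) = (\<Sum>i=\<delta>..e. k i choose i) + (k (Suc e) choose Suc e)"
      using step.hyps by simp
    also have "\<dots> < ((k e + 1) choose e) + (k (Suc e) choose Suc e)"
      using step by simp
    also have "\<dots> \<le> (k (Suc e) choose e) + (k (Suc e) choose Suc e)"
      using mono[of e] step by (intro add_right_mono binomial_right_mono) auto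
    finally show ?case by simp
  qed
  then show ?thesis using \<delta>(2) n by simp
qed

lemma binomial_expansion_ge:
  assumes "binomial_expansion d n \<delta> k"
  shows "k d choose d \<le> n"
  using assms unfolding binomial_expansion_def by (auto intro: member_le_sum)

lemma binomial_expansion_top:
  assumes "binomial_expansion d n \<delta> k" "binomial_expansion d n \<delta>' k'"
  shows "k d = k' d"
proof -
  have *: "\<not> k d < k' d"
    if "binomial_expansion d n \<delta> k" "binomial_expansion d n \<delta>' k'" for \<delta> \<delta>' k k'
  proof
    assume "k d < k' d"
    then have "(k d + 1) choose d \<le> k' d choose d" by (intro binomial_right_mono) simp
    then show False
      using binomial_expansion_less[OF that(1)] binomial_expansion_ge[OF that(2)] by simp
  qed
  show ?thesis using *[OF assms] *[OF assms(2,1)] by simp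
qed

lemma binomial_expansion_pos:
  assumes "binomial_expansion d n \<delta> k"
  shows "0 < n"
proof -
  have "0 < k \<delta> choose \<delta>" using assms by (auto simp: binomial_expansion_def)
  also have "\<dots> \<le> n" using assms by (auto simp: binomial_expansion_def intro: member_le_sum)
  finally show ?thesis .
qed

lemma binomial_expansion_Suc:
  assumes "binomial_expansion (Suc d) n \<delta> k" "\<delta> \<noteq> Suc d"
  shows "binomial_expansion d (n - (k (Suc d) choose Suc d)) \<delta> k"
  using assms by (auto simp: binomial_expansion_def)

lemma binomial_expansion_unique:
  assumes "binomial_expansion d n \<delta> k" "binomial_expansion d n \<delta>' k'"
  shows "\<delta> = \<delta>' \<and> (\<forall>i\<in>{\<delta>..d}. k i = k' i)"
  using assms
proof (induction d arbitrary: n)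
  case 0
  then show ?case by (simp add: binomial_expansion_def)
next
  case (Suc d)
  note top = binomial_expansion_top[OF Suc.prems]
  have *: "n = k (Suc d) choose Suc d" if "binomial_expansion (Suc d) n (Suc d) k" for k
    using that by (simp add: binomial_expansion_def)
  have **: "k (Suc d) choose Suc d < n" if "binomial_expansion (Suc d) n \<delta> k" "\<delta> \<noteq> Suc d" for \<delta> k
    using binomial_expansion_pos[OF binomial_expansion_Suc[OF that]] by simp
  show ?case
  proof (cases "\<delta> = Suc d")
    case True
    then have "\<delta>' = Suc d" using *[of k] **[OF Suc.prems(2)] Suc.prems(1) top by fastforce
    then show ?thesis using True top by simp
  next
    case False
    then have F': "\<delta>' \<noteq> Suc d" using *[of k'] **[OF Suc.prems(1)] Suc.prems(2) top by fastforce
    show ?thesis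
      using Suc.IH[OF binomial_expansion_Suc[OF Suc.prems(1) False]]
        binomial_expansion_Suc[OF Suc.prems(2) F'] top
      by (auto simp: le_Suc_eq)
  qed
qed

lemma binomial_expansion_exists:
  assumes "1 \<le> d" "1 \<le> n"
  shows "\<exists>\<delta> k. binomial_expansion d n \<delta> k"
  using assms
proof (induction d arbitrary: n)
  case 0
  then show ?case by simp
next
  case (Suc d)
  have bound: "K \<le> n + Suc d" if "K choose Suc d \<le> n" for K
  proof (rule ccontr)
    assume "\<not> K \<le> n + Suc d"
    then have "Suc (n + d) choose Suc d \<le> K choose Suc d" by (intro binomial_right_mono) simp
    moreover have "n + 1 \<le> Suc (n + d) choose Suc d"
    proof (induction n)
      case (Suc n)
      have "0 < Suc (n + d) choose d" by (intro zero_less_binomial) simp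
      moreover have "Suc (Suc n + d) choose Suc d =
          (Suc (n + d) choose d) + (Suc (n + d) choose Suc d)" by simp
      ultimately show ?case using Suc.IH by linarith
    qed simp
    ultimately show False using that by simp
  qed
  define K where "K = (GREATEST K. K choose Suc d \<le> n)"
  have K: "K choose Suc d \<le> n" unfolding K_def
    by (rule GreatestI_nat[where k = 0 and b = "n + Suc d"]) (use bound in auto)
  have max: "K' \<le> K" if "K' choose Suc d \<le> n" for K' unfolding K_def
    by (rule Greatest_le_nat[where b = "n + Suc d"]) (use that bound in auto)
  have Kd: "Suc d \<le> K" using max[of "Suc d"] Suc.prems by simp
  have r: "n - (K choose Suc d) < K choose d" using max[of "Suc K"] K by fastforce
  show ?case
  proof (cases "n = K choose Suc d")
    case True
    then have "binomial_expansion (Suc d) n (Suc d) (\<lambda>_. K)"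
      using Kd by (simp add: binomial_expansion_def)
    then show ?thesis by blast
  next
    case False
    then have "d \<noteq> 0" using r K by (cases d) auto
    then have "1 \<le> d" "1 \<le> n - (K choose Suc d)" using False K by auto
    then obtain \<delta> k where k: "binomial_expansion d (n - (K choose Suc d)) \<delta> k"
      using Suc.IH by blast
    have "k d choose d < K choose d" using binomial_expansion_ge[OF k] r by simp
    then have "k d < K" using binomial_right_mono[of K "k d" d] by (meson not_less)
    moreover have "(\<Sum>i=\<delta>..d. (k(Suc d := K)) i choose i) = (\<Sum>i=\<delta>..d. k i choose i)"
      by (intro sum.cong) auto
    ultimately have "binomial_expansion (Suc d) n \<delta> (k(Suc d := K))"
      using k K by (auto simp: binomial_expansion_def less_Suc_eq)
    then show ?thesis by blast
  qed
qed

lemma macaulay_growth_eq: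
  assumes "binomial_expansion d n \<delta> k"
  shows "macaulay_growth d n = (\<Sum>i=\<delta>..d. (k i + 1) choose (i + 1))"
proof -
  have "m = (\<Sum>i=\<delta>..d. (k i + 1) choose (i + 1))"
    if "binomial_expansion d n \<delta>' k'" "m = (\<Sum>i=\<delta>'..d. (k' i + 1) choose (i + 1))" for m \<delta>' k'
    using binomial_expansion_unique[OF assms that(1)] that(2) by (auto intro!: sum.cong)
  then have "(THE m. \<exists>\<delta> k. binomial_expansion d n \<delta> k \<and>
      m = (\<Sum>i=\<delta>..d. (k i + 1) choose (i + 1))) = (\<Sum>i=\<delta>..d. (k i + 1) choose (i + 1))"
    using assms by (intro the_equality) blast+
  then show ?thesis
    using binomial_expansion_pos[OF assms] by (simp only: macaulay_growth_def if_False less_not_refl2)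
qed

text \<open>
  A sequence \<open>(h\<^sub>0, \<dots>, h\<^sub>e)\<close> is given by its last index \<open>e\<close> and a function on the naturals whose
  values beyond \<open>e\<close> are irrelevant. Entries are integers because an \<open>O_sequence\<close> has to be tested
  on difference sequences, whose entries may be negative.
\<close>

definition O_sequence :: "nat \<Rightarrow> (nat \<Rightarrow> int) \<Rightarrow> bool" where
  "O_sequence e h \<longleftrightarrow>
     h 0 = 1 \<and> (\<forall>i\<le>e. 0 \<le> h i) \<and>
     (\<forall>d. 1 \<le> d \<and> d < e \<longrightarrow> h (d + 1) \<le> int (macaulay_growth d (nat (h d))))"

text \<open>
  A monomial is the multiset of its variables with multiplicity: divisibility is \<open>\<subseteq>#\<close> and the
  degree is \<open>size\<close>.
\<close>

definition order_ideal :: "'v multiset set \<Rightarrow> bool" where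
  "order_ideal M \<longleftrightarrow> finite M \<and> M \<noteq> {} \<and> (\<forall>m\<in>M. \<forall>m'. m' \<subseteq># m \<longrightarrow> m' \<in> M)"

definition maximal_monomial :: "'v multiset set \<Rightarrow> 'v multiset \<Rightarrow> bool" where
  "maximal_monomial M m \<longleftrightarrow> m \<in> M \<and> (\<forall>m'\<in>M. m \<subseteq># m' \<longrightarrow> m' = m)"

definition pure_order_ideal :: "nat \<Rightarrow> 'v multiset set \<Rightarrow> bool" where
  "pure_order_ideal e M \<longleftrightarrow> order_ideal M \<and> (\<forall>m. maximal_monomial M m \<longrightarrow> size m = e)"

text \<open>Finitely many monomials involve finitely many variables, so variables indexed by \<open>nat\<close>
  suffice.\<close>

definition pure_O_sequence :: "nat \<Rightarrow> (nat \<Rightarrow> nat) \<Rightarrow> bool" where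
  "pure_O_sequence e h \<longleftrightarrow>
     (\<exists>M :: nat multiset set. pure_order_ideal e M \<and> (\<forall>i\<le>e. h i = card {m \<in> M. size m = i}))"

definition nondecreasing_seq :: "nat \<Rightarrow> (nat \<Rightarrow> nat) \<Rightarrow> bool" where
  "nondecreasing_seq e h \<longleftrightarrow> (\<forall>i<e. h i \<le> h (i + 1))"

definition differentiable_seq :: "nat \<Rightarrow> (nat \<Rightarrow> nat) \<Rightarrow> bool" where
  "differentiable_seq e h \<longleftrightarrow>
     O_sequence e (\<lambda>i. if i = 0 then int (h 0) else int (h i) - int (h (i - 1)))"

end

theory Submission
  imports Defs
begin

text \<open>
  In socle degree 3 the monomials of degree 2 form a graph \<open>E\<close> with loops on the set \<open>V\<close> of variables,
  and those of degree 3 form a set \<open>F\<close> of (possibly degenerate) triangles of this graph. The point is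
  to show \<open>|F| \<le> |E| + g (|E| - |V|)\<close>, where \<open>g = macaulay_growth 2\<close>. This fails for arbitrary graphs,
  because of tree components; purity excludes them, in the form of Hall's condition that every set
  \<open>S\<close> of variables touches at least \<open>|S|\<close> edges.

  Under Hall's condition the bound follows by induction on \<open>|V|\<close>, removing a vertex of minimal
  degree \<open>d\<close>. It lies in at most \<open>(d + 1) choose 2\<close> triangles, which the growth of \<open>g\<close> compensates
  unless the graph is complete without loops. Hall's condition survives the removal unless the vertex
  lies in a union of loopless cycles that are components of the graph; this union is then removed
  as a whole.
\<close>

section \<open>Binomial identities and the values of \<open>macaulay_growth\<close> in degrees 1 and
  2\<close>

lemma choose_two_Suc: "Suc n choose 2 = n + (n choose 2)"
  by (simp add: numeral_2_eq_2)

lemma choose_two_add: "(a + b) choose 2 = (a choose 2) + (b choose 2) + a * b"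
  by (induction a) (simp_all add: choose_two_Suc algebra_simps)

lemma choose_three_Suc: "Suc n choose 3 = (n choose 2) + (n choose 3)"
  by (simp add: numeral_2_eq_2 numeral_3_eq_3)

lemma ex_choose_two_add: "\<exists>k j. n = (k choose 2) + j \<and> j < k"
proof (induction n)
  case 0
  have "0 = (1 choose 2) + 0 \<and> 0 < (1::nat)" by simp
  then show ?case by blast
next
  case (Suc n)
  then obtain k j where *: "n = (k choose 2) + j" "j < k" by blast
  show ?case
  proof (cases "Suc j < k")
    case True
    then show ?thesis using * by (intro exI[of _ k] exI[of _ "Suc j"]) simp
  next
    case False
    then have "k = Suc j" using *(2) by simp
    then show ?thesis
      using * by (intro exI[of _ "Suc k"] exI[of _ 0]) (simp add: choose_two_Suc)
  qed
qed

lemma macaulay_growth_1: "macaulay_growth 1 n = Suc n choose 2"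
proof (cases "n = 0")
  case True
  then show ?thesis by (simp add: macaulay_growth_def)
next
  case False
  then have "binomial_expansion 1 n 1 (\<lambda>_. n)" by (simp add: binomial_expansion_def)
  from macaulay_growth_eq[OF this] show ?thesis by (simp add: numeral_2_eq_2)
qed

text \<open>By \<open>ex_choose_two_add\<close> every natural number has the form on the left. The
  expansion has the second term \<open>j choose 1\<close> only for \<open>j > 0\<close>. The case
  \<open>k = 1\<close>, \<open>j = 0\<close> is the number 0, where the default value agrees with
  the formula.\<close>

lemma macaulay_growth_2:
  assumes "j < k"
  shows "macaulay_growth 2 ((k choose 2) + j) = (Suc k choose 3) + (Suc j choose 2)"
proof (cases "j = 0")
  case True
  show ?thesis
  proof (cases "k = 1")
    case True
    then show ?thesis using \<open>j = 0\<close> by (simp add: macaulay_growth_def)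
  next
    case False
    then have "binomial_expansion 2 (k choose 2) 2 (\<lambda>_. k)"
      using assms by (simp add: binomial_expansion_def)
    from macaulay_growth_eq[OF this] show ?thesis using True by simp
  qed
next
  case False
  define c where "c = (\<lambda>i::nat. if i = 1 then j else k)"
  have *: "{1..2::nat} = {1, 2}" by auto
  have "binomial_expansion 2 ((k choose 2) + j) 1 c"
    using False assms unfolding binomial_expansion_def * by (auto simp: c_def)
  from macaulay_growth_eq[OF this, unfolded *] show ?thesis
    by (simp add: c_def numeral_2_eq_2 numeral_3_eq_3)
qed

text \<open>The successive increments of \<open>macaulay_growth 2\<close> are 1; 1, 2; 1, 2, 3; and
  so on. The \<open>L\<close> increments ending at \<open>(k choose 2) + j\<close> are pairwise
  distinct positive integers because \<open>L < k\<close>, so their sum is at least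
  \<open>1 + ... + L\<close>.\<close>

lemma macaulay_growth_2_window:
  assumes "j < k" "L < k" "L \<le> (k choose 2) + j"
  shows "macaulay_growth 2 ((k choose 2) + j - L) + (Suc L choose 2)
       \<le> macaulay_growth 2 ((k choose 2) + j)"
proof (cases "L \<le> j")
  case True
  then obtain i where i: "j = L + i" using le_Suc_ex by blast
  then show ?thesis
    using macaulay_growth_2[of i k] macaulay_growth_2[of j k] assms
      choose_two_add[of "Suc L" i] by (simp add: choose_two_Suc)
next
  case False
  then obtain i where i: "L = j + i" "0 < i" using less_imp_add_positive[of j L] by auto
  obtain t where t: "k = Suc (L + t)" using assms(2) less_imp_Suc_add by blast
  \<comment> \<open>The window reaches into the previous block, so the expansion of the smaller
    number has leading entry \<open>k - 1 = L + t\<close>.\<close>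
  have *: "(k choose 2) + j - L = ((L + t) choose 2) + (j + t)"
    using i t by (simp add: choose_two_Suc)
  have "macaulay_growth 2 ((k choose 2) + j - L) = (k choose 3) + (Suc (j + t) choose 2)"
    unfolding * using macaulay_growth_2[of "j + t" "L + t"] i t by simp
  moreover have "macaulay_growth 2 ((k choose 2) + j) = (k choose 2) + (k choose 3) + (Suc j choose 2)"
    using macaulay_growth_2[OF assms(1)] by (simp add: choose_three_Suc)
  moreover have "(Suc (j + t) choose 2) + (Suc L choose 2) \<le> (k choose 2) + (Suc j choose 2)"
    using choose_two_add[of i "Suc (j + t)"] choose_two_add[of i "Suc j"] i(1) t
    by (simp add: add.commute add.left_commute)
  ultimately show ?thesis by linarith
qed

section \<open>Multisets of size two as edges, and graphs with loops\<close>

definition touching :: "'v multiset set \<Rightarrow> 'v set \<Rightarrow> 'v multiset set" where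
  "touching A S = {m \<in> A. set_mset m \<inter> S \<noteq> {}}"

lemma size_two_cases:
  assumes "size e = 2"
  obtains x y where "e = {#x, y#}"
proof -
  from assms obtain x e' where "e = add_mset x e'" "size e' = 1"
    by (metis Suc_1 size_eq_Suc_imp_eq_union size_add_mset Suc_inject)
  moreover from this obtain y where "e' = {#y#}" using size_1_singleton_mset by blast
  ultimately show ?thesis using that by blast
qed

lemma ex_loop_eq_iff: "(\<exists>z. {#x, y#} = {#z, z#}) \<longleftrightarrow> x = y"
proof
  assume "\<exists>z. {#x, y#} = {#z, z#}"
  then obtain z where "set_mset {#x, y#} = set_mset {#z, z#}" by metis
  then show "x = y" by auto
qed auto

text \<open>A one-element support comes only from a loop, a two-element support only from the edge
  joining its elements. Edges can therefore be counted as subsets.\<close>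

lemma inj_on_set_mset_size_two: "inj_on set_mset {e. size e = 2}"
proof (rule inj_onI)
  fix e e' :: "'a multiset"
  assume *: "e \<in> {e. size e = 2}" "e' \<in> {e. size e = 2}" "set_mset e = set_mset e'"
  then obtain x y x' y' where "e = {#x, y#}" "e' = {#x', y'#}"
    by (metis mem_Collect_eq size_two_cases)
  then show "e = e'" using *(3) by (auto simp: doubleton_eq_iff)
qed

lemma card_size_two_multisets_le:
  assumes "finite N" "\<And>e. e \<in> A \<Longrightarrow> size e = 2 \<and> set_mset e \<subseteq> N"
  shows "card A \<le> Suc (card N) choose 2"
proof -
  let ?B = "{B. B \<subseteq> N \<and> card B = 1} \<union> {B. B \<subseteq> N \<and> card B = 2}"
  have "set_mset e \<in> ?B" if "e \<in> A" for e
  proof -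
    have "size e = 2" using assms(2) that by simp
    then obtain x y where "e = {#x, y#}" by (rule size_two_cases)
    then show ?thesis using assms(2)[OF that] by (auto simp: card_insert_if)
  qed
  moreover have "inj_on set_mset A"
    using inj_on_set_mset_size_two by (rule inj_on_subset) (use assms(2) in auto)
  ultimately have "card A \<le> card ?B" using assms(1) by (intro card_inj_on_le) auto
  also have "\<dots> \<le> card {B. B \<subseteq> N \<and> card B = 1} + card {B. B \<subseteq> N \<and> card B = 2}"
    by (rule card_Un_le)
  also have "\<dots> = Suc (card N) choose 2"
    using assms(1) by (simp add: n_subsets choose_two_Suc)
  finally show ?thesis .
qed

lemma card_doubletons_le:
  assumes "finite N" "\<And>e. e \<in> A \<Longrightarrow> size e = 2 \<and> set_mset e \<subseteq> N \<and> (\<forall>x. e \<noteq> {#x, x#})"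
  shows "card A \<le> card N choose 2"
proof -
  have "set_mset e \<in> {B. B \<subseteq> N \<and> card B = 2}" if "e \<in> A" for e
  proof -
    have "size e = 2" using assms(2) that by simp
    then obtain x y where "e = {#x, y#}" by (rule size_two_cases)
    then show ?thesis using assms(2)[OF that] by (auto simp: card_insert_if)
  qed
  moreover have "inj_on set_mset A"
    using inj_on_set_mset_size_two by (rule inj_on_subset) (use assms(2) in auto)
  ultimately have "card A \<le> card {B. B \<subseteq> N \<and> card B = 2}"
    using assms(1) by (intro card_inj_on_le) auto
  then show ?thesis using assms(1) by (simp add: n_subsets)
qed

definition hall :: "'v set \<Rightarrow> 'v multiset set \<Rightarrow> bool" where
  "hall V E \<longleftrightarrow> (\<forall>S\<subseteq>V. card S \<le> card (touching E S))"

text \<open>Purity is left out because deleting vertices can destroy it. What survives deletion, by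
  \<open>remove\<close>, is that the degree 2 divisors of members of \<open>F\<close> lie in
  \<open>E\<close>.\<close>

locale looped_graph =
  fixes V :: "'v set" and E F :: "'v multiset set"
  assumes finite_V: "finite V" and finite_E: "finite E" and finite_F: "finite F"
    and edge: "e \<in> E \<Longrightarrow> size e = 2 \<and> set_mset e \<subseteq> V"
    and size_F: "m \<in> F \<Longrightarrow> size m = 3"
    and shadow: "m \<in> F \<Longrightarrow> e \<subseteq># m \<Longrightarrow> size e = 2 \<Longrightarrow> e \<in> E"
begin

text \<open>A loop counts once, which makes the degree equal to the number of neighbours, a looped
  vertex being its own neighbour.\<close>

definition degree :: "'v \<Rightarrow> nat" where
  "degree v = card (touching E {v})"

lemma finite_touching [simp]: "finite (touching E S)" "finite (touching F S)"
  using finite_E finite_F by (auto simp: touching_def)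

lemma remove: "looped_graph (V - W) (E - touching E W) (F - touching F W)"
proof
  fix m e assume m: "m \<in> F - touching F W" "e \<subseteq># m" "size e = 2"
  then have "set_mset e \<subseteq> set_mset m" by (simp add: set_mset_mono)
  then show "e \<in> E - touching E W" using m shadow by (auto simp: touching_def)
qed (use finite_V finite_E finite_F edge size_F in \<open>auto simp: touching_def\<close>)

lemma sum_degree:
  assumes "finite S"
  shows "(\<Sum>u\<in>S. degree u) = (\<Sum>e\<in>touching E S. card (set_mset e \<inter> S))"
proof -
  have "(\<Sum>u\<in>S. degree u) = (\<Sum>u\<in>S. \<Sum>e\<in>touching E S. of_bool (u \<in># e))"
    unfolding degree_def by (intro sum.cong refl) (auto simp: touching_def Int_def finite_E intro!: arg_cong[of _ _ card])
  also have "\<dots> = (\<Sum>e\<in>touching E S. \<Sum>u\<in>S. of_bool (u \<in># e))"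
    by (rule sum.swap)
  also have "\<dots> = (\<Sum>e\<in>touching E S. card (set_mset e \<inter> S))"
    using assms by (intro sum.cong refl) (auto simp: Int_def intro!: arg_cong[of _ _ card])
  finally show ?thesis .
qed

lemma card_edge_le: "e \<in> E \<Longrightarrow> card (set_mset e \<inter> S) \<le> 2"
proof -
  assume "e \<in> E"
  then have "size e = 2" using edge by blast
  then obtain x y where "e = {#x, y#}" by (rule size_two_cases)
  then have "card (set_mset e) \<le> 2" by (simp add: card_insert_if)
  then show ?thesis by (meson card_mono finite_set_mset inf_le1 order_trans)
qed

definition nbhd :: "'v \<Rightarrow> 'v set" where
  "nbhd v = {x. {#v, x#} \<in> E}"

lemma nbhd_subset: "nbhd v \<subseteq> V"
  using edge by (fastforce simp: nbhd_def)

lemma finite_nbhd: "finite (nbhd v)"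
  using nbhd_subset finite_V finite_subset by blast

lemma card_nbhd: "card (nbhd v) = degree v"
proof -
  have "(\<lambda>x. {#v, x#}) ` nbhd v = touching E {v}"
  proof
    show "touching E {v} \<subseteq> (\<lambda>x. {#v, x#}) ` nbhd v"
    proof
      fix e assume e: "e \<in> touching E {v}"
      then have "size e = 2" using edge by (auto simp: touching_def)
      then obtain x y where xy: "e = {#x, y#}" by (rule size_two_cases)
      then have "v = x \<or> v = y" using e by (auto simp: touching_def)
      then obtain z where "e = {#v, z#}" using xy by (metis add_mset_commute)
      then show "e \<in> (\<lambda>x. {#v, x#}) ` nbhd v" using e by (auto simp: touching_def nbhd_def)
    qed
  qed (auto simp: nbhd_def touching_def)
  moreover have "inj_on (\<lambda>x. {#v, x#}) (nbhd v)" by (auto simp: inj_on_def)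
  ultimately show ?thesis unfolding degree_def by (metis card_image)
qed

text \<open>Dividing a triangle at \<open>v\<close> by \<open>v\<close> gives an edge inside the
  neighbourhood of \<open>v\<close>, and multiplying by \<open>v\<close> recovers the triangle.
  Triangles at \<open>v\<close> are thus bounded by the possible edges on \<open>degree v\<close>
  vertices.\<close>

lemma link_F:
  assumes "m \<in> touching F {v}"
  shows "m - {#v#} \<in> E" "set_mset (m - {#v#}) \<subseteq> nbhd v"
proof -
  have m: "m \<in> F" "v \<in># m" using assms by (auto simp: touching_def)
  then show "m - {#v#} \<in> E" using shadow[of m "m - {#v#}"] size_F by (simp add: size_Diff_singleton)
  show "set_mset (m - {#v#}) \<subseteq> nbhd v"
  proof
    fix x assume "x \<in># m - {#v#}"
    then have "{#v, x#} \<subseteq># m" using m(2) by (simp add: insert_subset_eq_iff)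
    then show "x \<in> nbhd v" using shadow[OF m(1)] by (simp add: nbhd_def)
  qed
qed

lemma inj_on_link: "inj_on (\<lambda>m. m - {#v#}) (touching F {v})"
  by (auto simp: inj_on_def touching_def) (metis insert_DiffM)

lemma card_F_at_le: "card (touching F {v}) \<le> Suc (degree v) choose 2"
proof -
  have "card ((\<lambda>m. m - {#v#}) ` touching F {v}) \<le> Suc (card (nbhd v)) choose 2"
    using finite_nbhd link_F edge by (intro card_size_two_multisets_le) blast+
  then show ?thesis by (simp add: card_image[OF inj_on_link] card_nbhd)
qed

lemma card_F_at_le_loopless:
  assumes "\<And>x. x \<in> nbhd v \<Longrightarrow> {#x, x#} \<notin> E"
  shows "card (touching F {v}) \<le> degree v choose 2"
proof -
  have "size e = 2 \<and> set_mset e \<subseteq> nbhd v \<and> (\<forall>x. e \<noteq> {#x, x#})"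
    if e: "e \<in> (\<lambda>m. m - {#v#}) ` touching F {v}" for e
  proof -
    have "e \<in> E" "set_mset e \<subseteq> nbhd v" using e link_F by blast+
    then show ?thesis using edge assms by auto
  qed
  then have "card ((\<lambda>m. m - {#v#}) ` touching F {v}) \<le> card (nbhd v) choose 2"
    using finite_nbhd by (intro card_doubletons_le) blast+
  then show ?thesis by (simp add: card_image[OF inj_on_link] card_nbhd)
qed

section \<open>Hall's condition: its loss under deletion, a degree count, and its proof by
  discharging\<close>

text \<open>A set \<open>S\<close> violating the condition after the deletion gives
  \<open>W = insert v S\<close>. Hall's condition for \<open>W\<close> forces
  \<open>d \<ge> 2\<close>, while \<open>d \<ge> 3\<close> would leave enough edges at
  \<open>S\<close>. For \<open>d = 2\<close> double counting is tight, so \<open>W\<close> spans a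
  union of loopless cycles that no edge leaves.\<close>

lemma hall_remove_vertex:
  assumes "hall V E" "v \<in> V" and min: "\<And>u. u \<in> V \<Longrightarrow> degree v \<le> degree u"
    and not_hall: "\<not> hall (V - {v}) (E - touching E {v})"
  obtains W where "v \<in> W" "W \<subseteq> V" "card (touching E W) = card W"
    "\<And>u. u \<in> W \<Longrightarrow> degree u = 2" "\<And>e. e \<in> touching E W \<Longrightarrow> card (set_mset e \<inter> W) = 2"
proof -
  interpret G': looped_graph "V - {v}" "E - touching E {v}" "F - touching F {v}"
    by (rule remove)
  define d where "d = degree v"
  from not_hall obtain S where S: "S \<subseteq> V - {v}"
    and less: "card (touching (E - touching E {v}) S) < card S"
    by (auto simp: hall_def not_le)
  define E' where "E' = touching (E - touching E {v}) S"
  define W where "W = insert v S"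
  have finS: "finite S" using S finite_V finite_subset by blast
  have cW: "card W = Suc (card S)" using S finS by (subst W_def, subst card_insert_disjoint) auto
  have WV: "W \<subseteq> V" using S assms(2) by (auto simp: W_def)
  have "touching E W = E' \<union> touching E {v}" "E' \<inter> touching E {v} = {}"
    by (auto simp: E'_def W_def touching_def)
  then have cEW: "card (touching E W) = card E' + d"
    by (simp add: card_Un_disjoint d_def degree_def E'_def)
  moreover have "card W \<le> card (touching E W)" using assms(1) WV by (auto simp: hall_def)
  ultimately have "2 \<le> d" using cW less by (simp add: E'_def)
  have "d \<le> 2"
  proof (rule ccontr)
    assume "\<not> d \<le> 2"
    \<comment> \<open>A vertex of \<open>S\<close> loses at most its edge to \<open>v\<close>. All
      degrees at least 2 in \<open>S\<close> would give \<open>card S \<le> card E'\<close>.\<close>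
    have "2 \<le> G'.degree u" if "u \<in> S" for u
    proof -
      have "touching E {u} \<subseteq> touching (E - touching E {v}) {u} \<union> {{#v, u#}}"
      proof
        fix e assume e: "e \<in> touching E {u}"
        then have "size e = 2" using edge by (auto simp: touching_def)
        then obtain x y where "e = {#x, y#}" by (rule size_two_cases)
        then show "e \<in> touching (E - touching E {v}) {u} \<union> {{#v, u#}}"
          using e S that by (auto simp: touching_def add_mset_commute)
      qed
      then have "degree u \<le> card (touching (E - touching E {v}) {u} \<union> {{#v, u#}})"
        unfolding degree_def by (intro card_mono) auto
      also have "\<dots> \<le> G'.degree u + 1"
        unfolding G'.degree_def by (rule order_trans[OF card_Un_le]) simp
      finally show ?thesis using min[of u] that S \<open>\<not> d \<le> 2\<close> by (auto simp: d_def)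
    qed
    then have "(\<Sum>u\<in>S. 2) \<le> (\<Sum>u\<in>S. G'.degree u)" by (intro sum_mono)
    also have "\<dots> = (\<Sum>e\<in>E'. card (set_mset e \<inter> S))"
      unfolding E'_def by (rule G'.sum_degree[OF finS])
    also have "\<dots> \<le> (\<Sum>e\<in>E'. 2)"
      by (intro sum_mono G'.card_edge_le) (auto simp: E'_def touching_def)
    finally show False using less by (simp add: E'_def)
  qed
  then have d: "d = 2" using \<open>2 \<le> d\<close> by simp
  have finW: "finite W" using finS by (simp add: W_def)
  have le: "card (touching E W) \<le> card W" using cEW cW less d by (simp add: E'_def)
  have deg: "2 \<le> degree u" if "u \<in> W" for u using min[of u] that WV d by (auto simp: d_def)
  have edges: "card (set_mset e \<inter> W) \<le> 2" if "e \<in> touching E W" for e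
    using that card_edge_le by (auto simp: touching_def)
  have 1: "(\<Sum>u\<in>W. 2) \<le> (\<Sum>u\<in>W. degree u)" using deg by (intro sum_mono)
  have 2: "(\<Sum>e\<in>touching E W. card (set_mset e \<inter> W)) \<le> (\<Sum>e\<in>touching E W. 2)"
    using edges by (intro sum_mono)
  note 3 = sum_degree[OF finW]
  have 4: "(\<Sum>e\<in>touching E W. 2) \<le> (\<Sum>u\<in>W. 2::nat)" using le by simp
  \<comment> \<open>The four estimates form a closed cycle of inequalities from
    \<open>2 * card W\<close> back to itself, so each is an equality, and the two summed ones are
    equalities term by term.\<close>
  have "(\<Sum>u\<in>W. 2) = (\<Sum>u\<in>W. degree u)" using 1 2 3 4 by linarith
  then have A: "degree u = 2" if "u \<in> W" for u
    using sum_mono_inv[of "\<lambda>_. 2" W degree u] deg that finW by simp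
  have "(\<Sum>e\<in>touching E W. card (set_mset e \<inter> W)) = (\<Sum>e\<in>touching E W. 2)"
    using 1 2 3 4 by linarith
  then have B: "card (set_mset e \<inter> W) = 2" if "e \<in> touching E W" for e
    using sum_mono_inv[of "\<lambda>e. card (set_mset e \<inter> W)" "touching E W" "\<lambda>_. 2" e] edges that
    by simp
  have "card (touching E W) = card W" using 1 2 3 4 by simp
  then show ?thesis using that[of W] A B WV by (auto simp: W_def)
qed

text \<open>If all degrees exceed \<open>k\<close>, counting edges leaves only the complete loopless graph on
  \<open>k + 2\<close> vertices.\<close>

lemma min_degree_large:
  assumes "v \<in> V" and min: "\<And>u. u \<in> V \<Longrightarrow> degree v \<le> degree u"
    and n: "card E = card V + ((k choose 2) + j)" and k: "j < k" "2 \<le> k" "k < degree v"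
  shows "degree v = Suc k \<and> Suc j = k \<and> (\<forall>x. {#x, x#} \<notin> E)"
proof -
  define d where "d = degree v"
  \<comment> \<open>\<open>A\<close> is the set of loops, which contribute one incidence instead of
    two to the degree sum.\<close>
  define A where "A = {e \<in> E. card (set_mset e) = 1}"
  have AE: "A \<subseteq> E" "finite A" using finite_E by (auto simp: A_def)
  have "set_mset e \<inter> V \<noteq> {}" if "e \<in> E" for e
    using edge[OF that] by (cases "e = {#}") (auto simp: Int_absorb2)
  then have tE: "touching E V = E" by (auto simp: touching_def)
  have "card V * d = (\<Sum>u\<in>V. d)" by simp
  also have "\<dots> \<le> (\<Sum>u\<in>V. degree u)" using min by (intro sum_mono) (simp add: d_def)
  also have "\<dots> = (\<Sum>e\<in>E. card (set_mset e \<inter> V))" using sum_degree[OF finite_V] tE by simp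
  also have "\<dots> \<le> (\<Sum>e\<in>E. if e \<in> A then 1 else 2)"
  proof (rule sum_mono)
    fix e assume e: "e \<in> E"
    have "set_mset e \<inter> V = set_mset e" using edge[OF e] by auto
    then show "card (set_mset e \<inter> V) \<le> (if e \<in> A then 1 else 2)"
      using e card_edge_le[OF e, of V] by (auto simp: A_def)
  qed
  finally have "card V * d + card A \<le> (\<Sum>e\<in>E. (if e \<in> A then 1 else 2)) + (\<Sum>e\<in>E. if e \<in> A then 1 else 0)"
    using AE finite_E by (simp add: sum.If_cases Int_absorb1)
  also have "\<dots> = (\<Sum>e\<in>E. 2)" by (subst sum.distrib[symmetric]) (intro sum.cong, auto)
  finally have sumd: "card V * d + card A \<le> 2 * card V + 2 * (k choose 2) + 2 * j" using n by simp
  obtain q where q: "k = q + 2" using k(2) le_Suc_ex[of 2 k] by auto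
  have kk: "2 * (k choose 2) = k * (k - 1)" by (cases k) (auto simp: choose_two)
  obtain r where r: "d = k + 1 + r" using k(3) le_Suc_ex[of "Suc k" d] by (auto simp: d_def)
  have dV: "d \<le> card V"
    using card_mono[OF finite_V nbhd_subset, of v] by (simp add: card_nbhd d_def)
  have sum': "card V * (q + 1 + r) + card A \<le> (q + 2) * (q + 1) + 2 * j"
    using sumd kk unfolding r q by (simp add: algebra_simps)
  \<comment> \<open>With \<open>q = k - 2\<close> and \<open>j \<le> q + 1\<close>, the right side
    of \<open>sum'\<close> is at most \<open>(q + 4) * (q + 1)\<close>, which leaves no room for
    \<open>q + 5\<close> vertices.\<close>
  have Vle: "card V \<le> k + 2"
  proof (rule ccontr)
    assume "\<not> card V \<le> k + 2"
    then have "(q + 5) * (q + 1) \<le> card V * (q + 1 + r)" using q by (intro mult_mono) auto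
    then show False using sum' k(1) q by (simp add: algebra_simps)
  qed
  \<comment> \<open>If \<open>card V = d\<close>, every vertex is adjacent to all of
    \<open>V\<close>, itself included. The resulting \<open>card V\<close> loops violate
    \<open>sum'\<close>.\<close>
  have "card V \<noteq> d"
  proof
    assume Vd: "card V = d"
    have loop: "{#u, u#} \<in> A" if "u \<in> V" for u
    proof -
      have "nbhd u = V"
        using card_seteq[OF finite_V nbhd_subset[of u]] min[OF that] Vd
        by (simp add: card_nbhd d_def)
      then show ?thesis using that by (auto simp: nbhd_def A_def)
    qed
    have "inj_on (\<lambda>u. {#u, u#}) V" by (rule inj_onI) (auto dest: arg_cong[where f = set_mset])
    then have "card V \<le> card A" using loop AE by (intro card_inj_on_le) auto
    moreover have "(q + 3) * (q + 1) \<le> card V * (q + 1 + r)"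
      using Vd r q by (intro mult_mono) auto
    ultimately show False using sum' k(1) q Vd r by (simp add: algebra_simps)
  qed
  then have V: "card V = k + 2" "r = 0" using Vle dV r by auto
  then have "2 * q + 2 + card A \<le> 2 * j" using sum' q by (simp add: algebra_simps)
  then have j: "Suc j = k" "card A = 0" using k(1) q by auto
  then have "A = {}" using AE by simp
  then have "{#x, x#} \<notin> E" for x by (auto simp: A_def)
  then show ?thesis using j V r by (auto simp: d_def)
qed

text \<open>Discharging: every loop is assigned to its vertex, every other edge is shared equally between
  its loopless endpoints.\<close>

lemma hall_if_covered:
  assumes cover: "\<And>v. v \<in> V \<Longrightarrow> touching F {v} \<noteq> {}"
  shows "hall V E"
  unfolding hall_def
proof (intro allI impI)
  fix S assume S: "S \<subseteq> V"
  then have finS: "finite S" using finite_V finite_subset by blast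
  \<comment> \<open>\<open>A e\<close> is the set of vertices that receive charge from
    \<open>e\<close>. It is empty for an edge joining two distinct looped vertices, whose charge is
    discarded.\<close>
  define A where "A e = (if \<exists>x. e = {#x, x#} then set_mset e else {x \<in> set_mset e. {#x, x#} \<notin> E})"
    for e :: "'v multiset"
  define w where "w v e = (if v \<in> A e then 1 / real (card (A e)) else 0)" for v e
  have w_nonneg: "0 \<le> w v e" for v e by (simp add: w_def)
  have one: "1 \<le> (\<Sum>e\<in>touching E S. w v e)" if v: "v \<in> S" for v
  proof -
    have mem: "{#v, x#} \<in> touching E S" if "x \<in> nbhd v" for x
      using that v by (auto simp: nbhd_def touching_def)
    have single: ?thesis if "e \<in> touching E S" "A e = {v}" for e
      using member_le_sum[of e "touching E S" "w v"] that w_nonneg by (simp add: w_def)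
    show ?thesis
    proof (cases "{#v, v#} \<in> E")
      case True
      moreover have "A {#v, v#} = {v}" by (auto simp: A_def)
      ultimately show ?thesis using single mem[of v] by (auto simp: nbhd_def)
    next
      case no_loop: False
      show ?thesis
      proof (cases "\<exists>x \<in> nbhd v. {#x, x#} \<in> E")
        case True
        then obtain x where x: "x \<in> nbhd v" "{#x, x#} \<in> E" by blast
        then have "x \<noteq> v" using no_loop by blast
        \<comment> \<open>The looped neighbour takes no share, so \<open>v\<close> gets the whole
          charge of this edge.\<close>
        then have "A {#v, x#} = {v}" using x no_loop by (auto simp: A_def ex_loop_eq_iff)
        then show ?thesis using single mem[OF x(1)] by blast
      next
        case False
        \<comment> \<open>Here neither \<open>v\<close> nor any neighbour has a loop. A triangle at
          \<open>v\<close> then has two further distinct vertices, and each of its two edges at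
          \<open>v\<close> gives one half.\<close>
        obtain m where m: "m \<in> touching F {v}" using cover v S by blast
        have "size (m - {#v#}) = 2" using link_F(1)[OF m] edge by blast
        then obtain x y where xy: "m - {#v#} = {#x, y#}" by (rule size_two_cases)
        then have "x \<in> nbhd v" "y \<in> nbhd v" "{#x, y#} \<in> E" using link_F[OF m] by auto
        moreover have A2: "card (A {#v, z#}) = 2 \<and> v \<in> A {#v, z#}" if "z \<in> nbhd v" for z
        proof -
          have "z \<noteq> v" using no_loop that by (auto simp: nbhd_def)
          then have "A {#v, z#} = {v, z}"
            using no_loop False that by (auto simp: A_def ex_loop_eq_iff)
          then show ?thesis using \<open>z \<noteq> v\<close> by simp
        qed
        moreover have "x \<noteq> y" using False calculation(1,3) by blast
        ultimately have "(\<Sum>e\<in>{{#v, x#}, {#v, y#}}. w v e) = 1"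
          by (simp add: w_def)
        moreover have "(\<Sum>e\<in>{{#v, x#}, {#v, y#}}. w v e) \<le> (\<Sum>e\<in>touching E S. w v e)"
          using mem \<open>x \<in> nbhd v\<close> \<open>y \<in> nbhd v\<close> w_nonneg by (intro sum_mono2) auto
        ultimately show ?thesis by simp
      qed
    qed
  qed
  have "real (card S) = (\<Sum>v\<in>S. 1)" by simp
  also have "\<dots> \<le> (\<Sum>v\<in>S. \<Sum>e\<in>touching E S. w v e)" using one by (rule sum_mono)
  also have "\<dots> = (\<Sum>e\<in>touching E S. \<Sum>v\<in>S. w v e)" by (rule sum.swap)
  also have "\<dots> \<le> (\<Sum>e\<in>touching E S. 1)"
  proof (rule sum_mono)
    fix e
    have finA: "finite (A e)" by (simp add: A_def)
    have "(\<Sum>v\<in>S. w v e) = real (card (S \<inter> A e)) / real (card (A e))"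
      using finS by (simp add: w_def sum.If_cases Int_def)
    also have "\<dots> \<le> 1"
      \<comment> \<open>For empty \<open>A e\<close> the quotient is 0 by the convention for
        division by zero.\<close>
      using card_mono[OF finA, of "S \<inter> A e"] by (cases "card (A e) = 0") auto
    finally show "(\<Sum>v\<in>S. w v e) \<le> 1" .
  qed
  finally show "card S \<le> card (touching E S)" by simp
qed

end

section \<open>The bound on the number of triangles\<close>

lemma card_F_le:
  assumes "looped_graph V E F" "hall V E"
  shows "card F \<le> card E + macaulay_growth 2 (card E - card V)"
  using assms
proof (induction "card V" arbitrary: V E F rule: less_induct)
  case less
  interpret looped_graph V E F by fact
  have VE: "card V \<le> card E"
  proof -
    have "card V \<le> card (touching E V)" using less.prems(2) by (auto simp: hall_def)
    also have "\<dots> \<le> card E" using finite_E by (intro card_mono) (auto simp: touching_def)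
    finally show ?thesis .
  qed
  have cF: "card F = card (F - touching F W) + card (touching F W)" for W
    using finite_F card_Diff_subset[of "touching F W" F] card_mono[of F "touching F W"]
    by (auto simp: touching_def)
  have cE: "card E = card (E - touching E W) + card (touching E W)" for W
    using finite_E card_Diff_subset[of "touching E W" E] card_mono[of E "touching E W"]
    by (auto simp: touching_def)
  show ?case
  proof (cases "V = {}")
    case True
    have "F = {}"
    proof (rule ccontr)
      assume "F \<noteq> {}"
      then obtain m where m: "m \<in> F" by blast
      then have "m \<noteq> {#}" using size_F by fastforce
      then obtain v where "m \<in> touching F {v}" using m by (auto simp: touching_def)
      then show False using edge link_F(1) True by fastforce
    qed
    then show ?thesis by simp
  next
    case False
    obtain v where v: "v \<in> V" and min: "\<And>u. u \<in> V \<Longrightarrow> degree v \<le> degree u"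
      using arg_min_if_finite(1)[OF finite_V False] arg_min_least[OF finite_V False] by metis
    define d where "d = degree v"
    have cV: "card V = Suc (card (V - {v}))" using v finite_V card_Suc_Diff1 by metis
    show ?thesis
    proof (cases "hall (V - {v}) (E - touching E {v})")
      case True
      obtain k j where n: "card E - card V = (k choose 2) + j" and jk: "j < k"
        using ex_choose_two_add by blast
      have "card {v} \<le> card (touching E {v})" using less.prems(2) v unfolding hall_def by blast
      then have d1: "1 \<le> d" by (simp add: d_def degree_def)
      have "card (V - {v}) \<le> card (touching (E - touching E {v}) (V - {v}))"
        using True by (auto simp: hall_def)
      also have "\<dots> \<le> card (E - touching E {v})"
        using finite_E by (intro card_mono) (auto simp: touching_def)
      finally have VE': "card (V - {v}) \<le> card (E - touching E {v})" .
      have IH: "card (F - touching F {v}) \<le> card (E - touching E {v})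
          + macaulay_growth 2 (card (E - touching E {v}) - card (V - {v}))"
        using less.hyps[OF _ remove True] cV by simp
      have cE': "card E = card (E - touching E {v}) + d" using cE[of "{v}"] by (simp add: d_def degree_def)
      have n': "card (E - touching E {v}) - card (V - {v}) = (k choose 2) + j - (d - 1)"
        and dn: "d - 1 \<le> (k choose 2) + j"
        using n cE' cV VE VE' d1 by auto
      \<comment> \<open>Deleting \<open>v\<close> removes one vertex and \<open>d\<close> edges, so
        the argument of the growth function drops by \<open>d - 1\<close>. This inequality is what
        has to be added to the induction hypothesis.\<close>
      have "card (touching F {v}) + macaulay_growth 2 ((k choose 2) + j - (d - 1))
          \<le> d + macaulay_growth 2 ((k choose 2) + j)"
      proof (cases "d \<le> k")
        case True
        have "card (touching F {v}) \<le> d + (d choose 2)"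
          using card_F_at_le[of v] by (simp add: choose_two_Suc d_def)
        \<comment> \<open>The window of length \<open>L = d - 1\<close> pays for
          \<open>d choose 2\<close> triangles, and the \<open>d\<close> deleted edges pay for the
          rest.\<close>
        moreover have "macaulay_growth 2 ((k choose 2) + j - (d - 1)) + (d choose 2)
            \<le> macaulay_growth 2 ((k choose 2) + j)"
          using macaulay_growth_2_window[OF jk _ dn] True d1 by simp
        ultimately show ?thesis by linarith
      next
        case False
        \<comment> \<open>For \<open>k = 1\<close> the excess of edges over vertices is 0, so
          \<open>dn\<close> gives \<open>d \<le> 1\<close>, against \<open>k < d\<close>.\<close>
        have "2 \<le> k"
        proof (rule ccontr)
          assume "\<not> 2 \<le> k"
          then have "k = 1" "j = 0" using jk by auto
          then show False using False dn by (simp add: binomial_eq_0)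
        qed
        then have *: "d = Suc k" "Suc j = k" "\<And>x. {#x, x#} \<notin> E"
          using min_degree_large[OF v min _ jk] n VE False by (auto simp: d_def)
        obtain q where q: "k = Suc (Suc q)" using \<open>2 \<le> k\<close> by (metis Suc_le_D numeral_2_eq_2 Suc_le_mono)
        \<comment> \<open>The window is one too long here, but the absence of loops lowers the bound
          on triangles at \<open>v\<close> from \<open>Suc d choose 2\<close> to
          \<open>d choose 2\<close>.\<close>
        have "card (touching F {v}) \<le> d choose 2"
          using card_F_at_le_loopless *(3) by (simp add: d_def)
        moreover have "(k choose 2) + j - (d - 1) = (Suc q choose 2) + q"
          using * q by (simp add: choose_two_Suc)
        ultimately show ?thesis
          using macaulay_growth_2[OF jk] macaulay_growth_2[of q "Suc q"] * q
          by (simp add: choose_three_Suc choose_two_Suc add.commute add.left_commute)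
      qed
      then show ?thesis using IH cF[of "{v}"] cE' unfolding n n' by linarith
    next
      case False
      obtain W where W: "v \<in> W" "W \<subseteq> V" "card (touching E W) = card W"
        and deg: "\<And>u. u \<in> W \<Longrightarrow> degree u = 2"
        and edges: "\<And>e. e \<in> touching E W \<Longrightarrow> card (set_mset e \<inter> W) = 2"
        using hall_remove_vertex[OF less.prems(2) v min False] by blast
      have finW: "finite W" using W(2) finite_V finite_subset by blast
      \<comment> \<open>No edge leaves \<open>W\<close> and no edge at \<open>W\<close> is a
        loop.\<close>
      have closed: "set_mset e \<subseteq> W" "card (set_mset e) = 2" if "e \<in> touching E W" for e
      proof -
        have "card (set_mset e) \<le> 2" using card_edge_le[of e UNIV] that by (simp add: touching_def)
        then have "set_mset e \<inter> W = set_mset e"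
          using edges[OF that] by (intro card_seteq) auto
        then show "set_mset e \<subseteq> W" "card (set_mset e) = 2" using edges[OF that] by auto
      qed
      \<comment> \<open>Two loopless neighbours admit at most \<open>2 choose 2\<close> triangles.
        Summing over \<open>W\<close> bounds the lost triangles by \<open>card W\<close>, the number
        of lost edges.\<close>
      have "card (touching F {w}) \<le> 1" if "w \<in> W" for w
      proof -
        have loopless: "{#x, x#} \<notin> E" if x: "x \<in> nbhd w" for x
        proof
          assume "{#x, x#} \<in> E"
          moreover have "x \<in> W"
            using closed(1)[of "{#w, x#}"] x \<open>w \<in> W\<close> by (auto simp: nbhd_def touching_def)
          ultimately show False using closed(2)[of "{#x, x#}"] by (auto simp: touching_def)
        qed
        show ?thesis using card_F_at_le_loopless[of w, OF loopless] deg[OF that] by simp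
      qed
      then have "(\<Sum>w\<in>W. card (touching F {w})) \<le> (\<Sum>w\<in>W. 1)" by (intro sum_mono)
      moreover have "card (touching F W) \<le> (\<Sum>w\<in>W. card (touching F {w}))"
      proof -
        have "touching F W = (\<Union>w\<in>W. touching F {w})" by (auto simp: touching_def)
        then show ?thesis using card_UN_le[OF finW, of "\<lambda>w. touching F {w}"] by simp
      qed
      ultimately have FW: "card (touching F W) \<le> card W" by simp
      have "touching (E - touching E W) S = touching E S" if "S \<subseteq> V - W" for S
        using closed(1) that by (fastforce simp: touching_def)
      then have "hall (V - W) (E - touching E W)"
        using less.prems(2) by (auto simp: hall_def)
      moreover have cVW: "card V = card (V - W) + card W"
        using card_Diff_subset[OF finW W(2)] card_mono[OF finite_V W(2)] by simp
      moreover have "card W > 0" using W(1) finW card_gt_0_iff by blast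
      ultimately have "card (F - touching F W) \<le> card (E - touching E W)
          + macaulay_growth 2 (card (E - touching E W) - card (V - W))"
        using less.hyps[OF _ remove] by simp
      \<comment> \<open>As many edges as vertices disappear, so the growth term is
        unchanged.\<close>
      moreover have "card (E - touching E W) - card (V - W) = card E - card V"
        using cE[of W] W(3) cVW by simp
      ultimately show ?thesis using FW cF[of W] cE[of W] W(3) by simp
    qed
  qed
qed

section \<open>From pure order ideals to graphs, and the conclusion\<close>

text \<open>Among the multiples of \<open>m\<close> in \<open>M\<close>, one of largest degree is
  maximal in \<open>M\<close>, so purity fixes its degree.\<close>

lemma pure_order_ideal_extend:
  assumes "pure_order_ideal e M" "m \<in> M"
  obtains m' where "m' \<in> M" "m \<subseteq># m'" "size m' = e"
proof -
  define A where "A = {m' \<in> M. m \<subseteq># m'}"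
  have A: "finite A" "A \<noteq> {}"
    using assms by (auto simp: A_def pure_order_ideal_def order_ideal_def)
  then have "Max (size ` A) \<in> size ` A" by (intro Max_in) auto
  then obtain m' where m': "m' \<in> A" "size m' = Max (size ` A)" by auto
  have "m'' = m'" if "m'' \<in> M" "m' \<subseteq># m''" for m''
  proof -
    have "m'' \<in> A" using that m'(1) by (auto simp: A_def)
    then have "size m'' \<le> size m'" using A m'(2) by simp
    then show ?thesis
      using that(2) mset_subset_size[of m' m''] by (auto simp: subset_mset.less_le)
  qed
  then have "maximal_monomial M m'" using m'(1) by (auto simp: maximal_monomial_def A_def)
  then have "size m' = e" using assms(1) by (auto simp: pure_order_ideal_def)
  then show ?thesis using that m'(1) by (auto simp: A_def)
qed

lemma card_degree_one:
  "card {m \<in> M. size m = 1} = card {x. {#x#} \<in> M}"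
proof -
  have "(\<lambda>x. {#x#}) ` {x. {#x#} \<in> M} = {m \<in> M. size m = 1}"
    by (auto simp: image_iff dest: size_1_singleton_mset[unfolded One_nat_def])
  moreover have "inj_on (\<lambda>x. {#x#}) {x. {#x#} \<in> M}" by (simp add: inj_on_def)
  ultimately show ?thesis by (metis card_image)
qed

lemma order_ideal_looped_graph:
  assumes "order_ideal M"
  shows "looped_graph {x. {#x#} \<in> M} {m \<in> M. size m = 2} {m \<in> M. size m = 3}"
proof
  have fin: "finite M" and div: "\<And>m m'. m \<in> M \<Longrightarrow> m' \<subseteq># m \<Longrightarrow> m' \<in> M"
    using assms by (auto simp: order_ideal_def)
  then show "finite {m \<in> M. size m = 2}" "finite {m \<in> M. size m = 3}" by auto
  have "(\<lambda>x. {#x#}) ` {x. {#x#} \<in> M} \<subseteq> M" by auto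
  then have "finite ((\<lambda>x. {#x#}) ` {x. {#x#} \<in> M})" using fin finite_subset by blast
  then show "finite {x. {#x#} \<in> M}" by (rule finite_imageD) (simp add: inj_on_def)
  show "size e = 2 \<and> set_mset e \<subseteq> {x. {#x#} \<in> M}" if "e \<in> {m \<in> M. size m = 2}" for e
    using that div by auto
  show "size m = 3" if "m \<in> {m \<in> M. size m = 3}" for m using that by simp
  show "e \<in> {m \<in> M. size m = 2}"
    if "m \<in> {m \<in> M. size m = 3}" "e \<subseteq># m" "size e = 2" for m e
    using that div by auto
qed

theorem theorem3p3:
  fixes e :: nat and h :: "nat \<Rightarrow> nat"
  assumes "e \<le> 3"
    and "pure_O_sequence e h"
    and "nondecreasing_seq e h"
  shows "differentiable_seq e h"
proof -
  obtain M :: "nat multiset set" where M: "pure_order_ideal e M"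
    and h: "\<And>i. i \<le> e \<Longrightarrow> h i = card {m \<in> M. size m = i}"
    using assms(2) unfolding pure_O_sequence_def by blast
  then have ideal: "order_ideal M" by (simp add: pure_order_ideal_def)
  define V where "V = {x. {#x#} \<in> M}"
  interpret looped_graph V "{m \<in> M. size m = 2}" "{m \<in> M. size m = 3}"
    unfolding V_def by (rule order_ideal_looped_graph[OF ideal])
  have mono: "h i \<le> h (Suc i)" if "i < e" for i
    using assms(3) that by (simp add: nondecreasing_seq_def)
  have "{m \<in> M. size m = 0} = {{#}}"
    using ideal by (auto simp: order_ideal_def)
  then have h0: "h 0 = 1" using h[of 0] by simp
  have h1: "h 1 = card V" if "1 \<le> e"
    using h[OF that] card_degree_one[of M] by (simp add: V_def)
  have deg2: "int (h 2) - int (h 1) \<le> int (macaulay_growth 1 (nat (int (h 1) - int (h 0))))"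
    if "2 \<le> e"
  proof -
    have "h 2 \<le> Suc (card V) choose 2"
      unfolding h[OF that] using finite_V edge by (rule card_size_two_multisets_le)
    then have "h 2 \<le> h 1 + (h 1 choose 2)" using h1 that by (simp add: choose_two_Suc)
    \<comment> \<open>Since \<open>h 0 = 1\<close>, the growth of \<open>h 1 - h 0\<close> in degree
      1 is \<open>h 1 choose 2\<close>, exactly the number of possible non-loop edges.\<close>
    moreover have "Suc (nat (int (h 1) - int (h 0))) = h 1"
      using mono[of 0] h0 that by simp
    ultimately show ?thesis unfolding macaulay_growth_1 by simp
  qed
  have deg3: "int (h 3) - int (h 2) \<le> int (macaulay_growth 2 (nat (int (h 2) - int (h 1))))"
    if "e = 3"
  proof -
    \<comment> \<open>Purity enters here: every variable divides a monomial of degree 3.\<close>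
    have "hall V {m \<in> M. size m = 2}"
    proof (rule hall_if_covered)
      fix v assume "v \<in> V"
      then have "{#v#} \<in> M" by (simp add: V_def)
      then obtain m where "m \<in> M" "{#v#} \<subseteq># m" "size m = 3"
        using pure_order_ideal_extend[OF M] \<open>e = 3\<close> by metis
      then show "touching {m \<in> M. size m = 3} {v} \<noteq> {}" by (auto simp: touching_def)
    qed
    from card_F_le[OF looped_graph_axioms this]
    have "h 3 \<le> h 2 + macaulay_growth 2 (h 2 - h 1)" using h h1 that by simp
    moreover have "nat (int (h 2) - int (h 1)) = h 2 - h 1" by linarith
    ultimately show ?thesis by simp
  qed
  show ?thesis
    unfolding differentiable_seq_def O_sequence_def
  proof (intro conjI allI impI)
    fix i assume "i \<le> e"
    then show "0 \<le> (if i = 0 then int (h 0) else int (h i) - int (h (i - 1)))"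
      using mono[of "i - 1"] by auto
  next
    fix d assume "1 \<le> d \<and> d < e"
    then consider "d = 1" "2 \<le> e" | "d = 2" "e = 3" using assms(1) by linarith
    then show "(if d + 1 = 0 then int (h 0) else int (h (d + 1)) - int (h (d + 1 - 1)))
        \<le> int (macaulay_growth d (nat (if d = 0 then int (h 0) else int (h d) - int (h (d - 1)))))"
      by cases (use deg2 deg3 in \<open>simp_all add: numeral_2_eq_2 numeral_3_eq_3\<close>)
  qed (simp add: h0)
qed

end
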